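(* For $1\le\iota\le n$ and $(r,s,i,j)\in\mu^{-1}(0)^{rss}$ put $H_\iota(r,s,i,j):=r_{\iota\iota}$. Then $$H_\iota(r,s,i,j)=\left[\mathrm{tr}\Big(\prod_{1\le k\le n,\,k\neq\iota}l_k(r)\Big)\right]^{-1}\mathrm{tr}\Big(\prod_{1\le k\le n,\,k\ne\iota}l_k(r)\;r\Big),$$ and this is a $B$-invariant function.
   Context: Let $n\ge 1$, $\mathfrak{g}=\mathfrak{gl}_n(\mathbb{C})$, $B\subset GL_n(\mathbb{C})$ the group of invertible upper triangular matrices, $\mathfrak{b}$ the upper triangular matrices, $\mathfrak{u}\subset\mathfrak{g}$ the strictly upper triangular matrices. Identify $\mathfrak{b}^*\cong\mathfrak{g}/\mathfrak{u}$ via the trace pairing; $\overline{v}$ is the class of $v$ in $\mathfrak{g}/\mathfrak{u}$. $T^*(\mathfrak{b}\times\mathbb{C}^n)=\mathfrak{b}\times\mathfrak{b}^*\times\mathbb{C}^n\times(\mathbb{C}^n)^*$ has points $(r,s,i,j)$, $i$ a column vector and $j$ a row vector. $B$ acts by $b.(r,s,i,j)=(brb^{-1},\overline{bsb^{-1}},bi,jb^{-1})$. The moment map is $\mu(r,s,i,j)=\overline{[r,s]+ij}\in\mathfrak{b}^*$, and $\mu^{-1}(0)^{rss}$ is the set of $(r,s,i,j)\in\mu^{-1}(0)$ with $r$ having pairwise distinct eigenvalues. For $r=(r_{\iota\gamma})\in\mathfrak{b}$, $l_k(r)=r-r_{kk}I_n$ (empty product is $I_n$). *)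

theory Defs
  imports "HOL-Algebra.AbelCoset" "Jordan_Normal_Form.Spectral_Radius"
begin

text \<open>
  Matrices are those of the Jordan_Normal_Form entry, so the size \<open>n\<close> is an ordinary natural
  number. Row and column indices run over \<open>0, ..., n - 1\<close>, not \<open>1, ..., n\<close>.
\<close>

abbreviation gl :: "nat \<Rightarrow> complex mat ring" where
  "gl n \<equiv> ring_mat TYPE(complex) n ()"

definition borel_alg :: "nat \<Rightarrow> complex mat set" where
  "borel_alg n = {A \<in> carrier_mat n n. upper_triangular A}"

definition nil_alg :: "nat \<Rightarrow> complex mat set" where
  "nil_alg n = {A \<in> carrier_mat n n. \<forall>i<n. \<forall>j\<le>i. A $$ (i, j) = 0}"

definition borel_grp :: "nat \<Rightarrow> complex mat set" where
  "borel_grp n = {b \<in> Units (gl n). upper_triangular b}"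

abbreviation minv :: "nat \<Rightarrow> complex mat \<Rightarrow> complex mat" where
  "minv n b \<equiv> inv\<^bsub>gl n\<^esub> b"

text \<open>
  The dual of the Borel subalgebra is identified, by the trace pairing, with the quotient of all
  matrices by the strictly upper triangular ones; its elements are additive cosets.
\<close>

definition cls :: "nat \<Rightarrow> complex mat \<Rightarrow> complex mat set" where
  "cls n v = nil_alg n +>\<^bsub>gl n\<^esub> v"

definition borel_dual :: "nat \<Rightarrow> complex mat set set" where
  "borel_dual n = a_rcosets\<^bsub>gl n\<^esub> (nil_alg n)"

text \<open>
  Points \<open>(r, s, i, j)\<close>: the second component is a coset, the column vector \<open>i\<close> is an
  \<open>n \<times> 1\<close> matrix and the row vector \<open>j\<close> is a \<open>1 \<times> n\<close> matrix, so that \<open>i * j\<close> is the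
  matrix product.
\<close>

type_synonym point = "complex mat \<times> complex mat set \<times> complex mat \<times> complex mat"

definition cotangent :: "nat \<Rightarrow> point set" where
  "cotangent n = borel_alg n \<times> borel_dual n \<times> carrier_mat n 1 \<times> carrier_mat 1 n"

text \<open>
  The action and the moment map are given on representatives of the second component; the unions
  run over all representatives, which all contribute the same coset
  (see \<open>act_cls\<close> and \<open>moment_cls\<close> below).
\<close>

definition act :: "nat \<Rightarrow> complex mat \<Rightarrow> point \<Rightarrow> point" where
  "act n b = (\<lambda>(r, s, i, j).
     (b * r * minv n b, \<Union>v\<in>s. cls n (b * v * minv n b), b * i, j * minv n b))"

definition moment :: "nat \<Rightarrow> point \<Rightarrow> complex mat set" where
  "moment n = (\<lambda>(r, s, i, j). \<Union>v\<in>s. cls n ((r * v - v * r) + i * j))"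

definition moment_zero :: "nat \<Rightarrow> point set" where
  "moment_zero n = {x \<in> cotangent n. moment n x = cls n (0\<^sub>m n n)}"

text \<open>
  A matrix of size \<open>n\<close> has pairwise distinct eigenvalues when it has \<open>n\<close> of them.
\<close>

definition moment_zero_rss :: "nat \<Rightarrow> point set" where
  "moment_zero_rss n = {(r, s, i, j) \<in> moment_zero n. card (spectrum r) = n}"

definition B_invariant_on :: "nat \<Rightarrow> point set \<Rightarrow> (point \<Rightarrow> complex) \<Rightarrow> bool" where
  "B_invariant_on n X f \<longleftrightarrow>
     (\<forall>b\<in>borel_grp n. \<forall>x\<in>X. act n b x \<in> X \<and> f (act n b x) = f x)"

definition mat_trace :: "complex mat \<Rightarrow> complex" where
  "mat_trace A = (\<Sum>k<dim_row A. A $$ (k, k))"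

definition l_mat :: "nat \<Rightarrow> nat \<Rightarrow> complex mat \<Rightarrow> complex mat" where
  "l_mat n k r = r - r $$ (k, k) \<cdot>\<^sub>m 1\<^sub>m n"

text \<open>
  The factors commute (see \<open>l_mat_commute\<close> below), so multiplying them in increasing order of the
  index is no restriction.
\<close>

definition l_prod :: "nat \<Rightarrow> nat \<Rightarrow> complex mat \<Rightarrow> complex mat" where
  "l_prod n \<iota> r = foldr (\<lambda>k M. l_mat n k r * M) (filter (\<lambda>k. k \<noteq> \<iota>) [0..<n]) (1\<^sub>m n)"

definition H_fun :: "nat \<Rightarrow> point \<Rightarrow> complex" where
  "H_fun \<iota> = (\<lambda>(r, s, i, j). r $$ (\<iota>, \<iota>))"


lemma l_mat_commute:
  assumes r: "r \<in> carrier_mat n n"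
  shows "l_mat n k r * l_mat n m r = l_mat n m r * l_mat n k r"
proof -
  have *: "(r - a \<cdot>\<^sub>m 1\<^sub>m n) * (r - c \<cdot>\<^sub>m 1\<^sub>m n) = r * r - c \<cdot>\<^sub>m r - a \<cdot>\<^sub>m r + (a * c) \<cdot>\<^sub>m 1\<^sub>m n" for a c
  proof -
    have "(r - a \<cdot>\<^sub>m 1\<^sub>m n) * (r - c \<cdot>\<^sub>m 1\<^sub>m n)
        = r * (r - c \<cdot>\<^sub>m 1\<^sub>m n) - (a \<cdot>\<^sub>m 1\<^sub>m n) * (r - c \<cdot>\<^sub>m 1\<^sub>m n)"
      using r by (intro minus_mult_distrib_mat[where nr = n and n = n and nc = n]) auto
    also have "r * (r - c \<cdot>\<^sub>m 1\<^sub>m n) = r * r - r * (c \<cdot>\<^sub>m 1\<^sub>m n)"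
      using r by (intro mult_minus_distrib_mat[where nr = n and n = n and nc = n]) auto
    also have "r * (c \<cdot>\<^sub>m 1\<^sub>m n) = c \<cdot>\<^sub>m r"
      using r by (subst mult_smult_distrib[where nr = n and n = n and nc = n]) auto
    also have "(a \<cdot>\<^sub>m 1\<^sub>m n) * (r - c \<cdot>\<^sub>m 1\<^sub>m n) = a \<cdot>\<^sub>m (r - c \<cdot>\<^sub>m 1\<^sub>m n)"
      using r by (subst mult_smult_assoc_mat[where nr = n and n = n and nc = n]) auto
    finally show ?thesis using r by (auto intro!: eq_matI simp: algebra_simps)
  qed
  show ?thesis unfolding l_mat_def * using r
    by (auto intro!: eq_matI simp: algebra_simps)
qed

lemma nil_alg_mult:
  assumes "A \<in> nil_alg n" "B \<in> borel_alg n"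
  shows "A * B \<in> nil_alg n" "B * A \<in> nil_alg n"
proof -
  have A: "A \<in> carrier_mat n n" "\<And>i j. i < n \<Longrightarrow> j \<le> i \<Longrightarrow> A $$ (i, j) = 0"
    using assms by (auto simp: nil_alg_def)
  have B: "B \<in> carrier_mat n n" "\<And>i j. i < n \<Longrightarrow> j < i \<Longrightarrow> B $$ (i, j) = 0"
    using assms by (auto simp: borel_alg_def)
  have "A $$ (i, k) * B $$ (k, j) = 0" "B $$ (i, k) * A $$ (k, j) = 0"
    if "i < n" "j \<le> i" "k < n" for i j k
  proof -
    show "A $$ (i, k) * B $$ (k, j) = 0"
      using A(2)[of i k] B(2)[of k j] that by (cases "k \<le> i") auto
    show "B $$ (i, k) * A $$ (k, j) = 0"
      using B(2)[of i k] A(2)[of k j] that by (cases "k < i") auto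
  qed
  then show "A * B \<in> nil_alg n" "B * A \<in> nil_alg n"
    using A(1) B(1) by (auto simp: nil_alg_def scalar_prod_def intro!: sum.neutral)
qed

lemma nil_alg_add:
  "A \<in> nil_alg n \<Longrightarrow> B \<in> nil_alg n \<Longrightarrow> A + B \<in> nil_alg n"
  "A \<in> nil_alg n \<Longrightarrow> B \<in> nil_alg n \<Longrightarrow> A - B \<in> nil_alg n"
  by (auto simp: nil_alg_def)

lemma UN_const_rep:
  assumes "x \<in> S" "\<And>y. y \<in> S \<Longrightarrow> f y = c"
  shows "(\<Union>y\<in>S. f y) = c"
  using assms by blast

lemma cls_iff: "w \<in> cls n v \<longleftrightarrow> (\<exists>u\<in>nil_alg n. w = u + v)"
  by (auto simp: cls_def a_r_coset_def r_coset_def ring_mat_simps)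

lemma cls_self:
  assumes "v \<in> carrier_mat n n"
  shows "v \<in> cls n v"
  unfolding cls_iff using assms
  by (intro bexI[of _ "0\<^sub>m n n"]) (auto simp: nil_alg_def)

lemma cls_shift:
  assumes "u \<in> nil_alg n" "v \<in> carrier_mat n n"
  shows "cls n (u + v) = cls n v"
proof -
  have u: "u \<in> carrier_mat n n" using assms by (auto simp: nil_alg_def)
  have "w + (u + v) = (w + u) + v" if "w \<in> nil_alg n" for w
    using that u assms by (auto simp: nil_alg_def intro!: eq_matI)
  moreover have "w + v = (w - u) + (u + v)" if "w \<in> nil_alg n" for w
    using that u assms by (auto simp: nil_alg_def intro!: eq_matI)
  ultimately show ?thesis
    using nil_alg_add assms(1) unfolding set_eq_iff cls_iff by metis
qed

lemma minv_props:
  assumes "b \<in> Units (gl n)"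
  shows "b \<in> carrier_mat n n" "minv n b \<in> carrier_mat n n"
    "b * minv n b = 1\<^sub>m n" "minv n b * b = 1\<^sub>m n"
proof -
  interpret ring "gl n" by (rule ring_mat)
  show "b \<in> carrier_mat n n" "minv n b \<in> carrier_mat n n"
    "b * minv n b = 1\<^sub>m n" "minv n b * b = 1\<^sub>m n"
    using assms Units_closed[OF assms] Units_inv_closed[OF assms]
      Units_r_inv[OF assms] Units_l_inv[OF assms]
    by (auto simp: ring_mat_simps)
qed

lemma minv_upper:
  assumes "b \<in> borel_grp n"
  shows "minv n b \<in> borel_alg n"
proof -
  have bU: "b \<in> Units (gl n)" and ub: "upper_triangular b"
    using assms by (auto simp: borel_grp_def)
  define c where "c = minv n b"
  note P = minv_props[OF bU, folded c_def]
  have "det b \<noteq> 0" using unit_imp_det_non_zero[OF bU] .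
  then have diag: "b $$ (i, i) \<noteq> 0" if "i < n" for i
    using det_upper_triangular[OF ub P(1)] that P(1) by (auto simp: prod_list_diag_prod)
  have "c $$ (i, j) = 0" if "i < n" "j < i" for i j
    using that
  proof (induction "n - i" arbitrary: i rule: less_induct)
    case less
    have "0 = (b * c) $$ (i, j)" using less.prems P(3) by auto
    also have "\<dots> = (\<Sum>k<n. b $$ (i, k) * c $$ (k, j))"
      using less.prems P(1,2) by (auto simp: scalar_prod_def lessThan_atLeast0)
    also have "\<dots> = (\<Sum>k<n. if k = i then b $$ (i, i) * c $$ (i, j) else 0)"
    proof (rule sum.cong[OF refl])
      fix k assume "k \<in> {..<n}"
      then have k: "k < n" by simp
      consider "k < i" | "k = i" | "i < k" by linarith
      then show "b $$ (i, k) * c $$ (k, j)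
          = (if k = i then b $$ (i, i) * c $$ (i, j) else 0)"
      proof cases
        case 1
        then show ?thesis using upper_triangularD[OF ub, of k i] less.prems P(1) by auto
      next
        case 3
        then show ?thesis using less.hyps[of k] less.prems k by auto
      qed auto
    qed
    also have "\<dots> = b $$ (i, i) * c $$ (i, j)" using less.prems by simp
    finally show ?case using diag less.prems by auto
  qed
  then show ?thesis using P(2) unfolding c_def borel_alg_def by auto
qed

lemma moment_cls:
  assumes r: "r \<in> borel_alg n" and s: "s \<in> carrier_mat n n"
    and i: "i \<in> carrier_mat n 1" and j: "j \<in> carrier_mat 1 n"
  shows "moment n (r, cls n s, i, j) = cls n ((r * s - s * r) + i * j)"
proof -
  have r': "r \<in> carrier_mat n n" using r by (auto simp: borel_alg_def)
  have "cls n ((r * v - v * r) + i * j) = cls n ((r * s - s * r) + i * j)"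
    if v: "v \<in> cls n s" for v
  proof -
    obtain u where u: "u \<in> nil_alg n" "v = u + s" using v by (auto simp: cls_iff)
    have u': "u \<in> carrier_mat n n" using u by (auto simp: nil_alg_def)
    have "r * v = r * u + r * s" "v * r = u * r + s * r"
      unfolding u(2) using mult_add_distrib_mat[OF r' u' s] add_mult_distrib_mat[OF u' s r'] by auto
    then have "(r * v - v * r) + i * j = (r * u - u * r) + ((r * s - s * r) + i * j)"
      using r' u' s i j by (auto intro!: eq_matI)
    moreover have "r * u - u * r \<in> nil_alg n"
      using nil_alg_mult[OF u(1) r] nil_alg_add by auto
    ultimately show ?thesis using r' s i j by (simp add: cls_shift)
  qed
  then have "(\<Union>v\<in>cls n s. cls n ((r * v - v * r) + i * j)) = cls n ((r * s - s * r) + i * j)"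
    by (rule UN_const_rep[OF cls_self[OF s]])
  then show ?thesis by (simp only: moment_def prod.case)
qed

lemma act_cls:
  assumes b: "b \<in> borel_grp n" and s: "s \<in> carrier_mat n n"
  shows "act n b (r, cls n s, i, j)
    = (b * r * minv n b, cls n (b * s * minv n b), b * i, j * minv n b)"
proof -
  define c where "c = minv n b"
  have bU: "b \<in> Units (gl n)" using b by (auto simp: borel_grp_def)
  note P = minv_props[OF bU, folded c_def]
  have cB: "c \<in> borel_alg n" using minv_upper[OF b] by (simp add: c_def)
  have bB: "b \<in> borel_alg n" using b P(1) by (auto simp: borel_alg_def borel_grp_def)
  have "cls n (b * v * c) = cls n (b * s * c)" if v: "v \<in> cls n s" for v
  proof -
    obtain u where u: "u \<in> nil_alg n" "v = u + s" using v by (auto simp: cls_iff)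
    have u': "u \<in> carrier_mat n n" using u by (auto simp: nil_alg_def)
    have "b * v * c = b * u * c + b * s * c"
      unfolding u(2) using mult_add_distrib_mat[OF P(1) u' s]
        add_mult_distrib_mat[of "b * u" n n "b * s" c n] P u' s by auto
    moreover have "b * u * c \<in> nil_alg n"
      using nil_alg_mult(1)[OF nil_alg_mult(2)[OF u(1) bB] cB] .
    ultimately show ?thesis using P s by (simp add: cls_shift)
  qed
  then have "(\<Union>v\<in>cls n s. cls n (b * v * c)) = cls n (b * s * c)"
    by (rule UN_const_rep[OF cls_self[OF s]])
  then show ?thesis by (simp only: act_def prod.case c_def)
qed

lemma borel_dual_eq: "borel_dual n = cls n ` carrier_mat n n"
  by (auto simp: borel_dual_def A_RCOSETS_def RCOSETS_def cls_def a_r_coset_def ring_mat_simps)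

end

theory Submission
  imports Defs
begin

text \<open>
  The diagonal is multiplicative on upper triangular matrices: taking the \<open>(k, k)\<close> entry is a ring
  homomorphism on the Borel subalgebra (\<open>borel_mult_diag\<close>). The formula for \<open>H_\<iota>\<close> and its
  invariance both follow from this.

  For the formula, the \<open>(k, k)\<close> entry of the product of the \<open>l_m(r)\<close> with \<open>m \<noteq> \<iota>\<close> is
  \<open>\<Prod>m\<noteq>\<iota>. (r_kk - r_mm)\<close>. For \<open>k \<noteq> \<iota>\<close> the factor \<open>m = k\<close> kills it, so the trace of the product
  is its \<open>(\<iota>, \<iota>)\<close> entry alone, and multiplying by \<open>r\<close> scales this trace by \<open>r_\<iota>\<iota>\<close>. The entry is
  nonzero because the eigenvalues of an upper triangular matrix are its diagonal entries, so \<open>n\<close>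
  eigenvalues force the diagonal entries to be distinct (\<open>card_spectrum_borel_iff\<close>).

  For the invariance, \<open>b_kk\<close> and \<open>(b\<inverse>)_kk\<close> are inverse to each other, so conjugation by \<open>b\<close> fixes
  the diagonal of \<open>r\<close>. In particular it preserves the condition on the spectrum. The zero fibre of
  the moment map is stable because the condition there is \<open>[r, s] + i j \<in> \<uu>\<close>, the left-hand side is
  equivariant, and \<open>\<uu>\<close> is stable under conjugation by \<open>B\<close>.
\<close>

section \<open>Diagonals of upper triangular matrices\<close>

lemma borel_algD:
  assumes "A \<in> borel_alg n"
  shows "A \<in> carrier_mat n n" "upper_triangular A"
  using assms by (auto simp: borel_alg_def)

lemma borel_alg_iff:
  "A \<in> borel_alg n \<longleftrightarrow> A \<in> carrier_mat n n \<and> (\<forall>i<n. \<forall>j<i. A $$ (i, j) = 0)"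
  by (auto simp: borel_alg_def upper_triangular_def)

text \<open>
  In \<open>\<Sum>m. A_km B_mk\<close> the terms with \<open>m < k\<close> vanish because of \<open>A\<close> and those with \<open>m > k\<close>
  because of \<open>B\<close>.
\<close>

lemma borel_mult_diag:
  assumes A: "A \<in> borel_alg n" and B: "B \<in> borel_alg n" and k: "k < n"
  shows "(A * B) $$ (k, k) = A $$ (k, k) * B $$ (k, k)"
proof -
  note c = borel_algD[OF A] borel_algD[OF B]
  have "(A * B) $$ (k, k) = (\<Sum>m\<in>{0..<n}. A $$ (k, m) * B $$ (m, k))"
    using c k by (auto simp: scalar_prod_def)
  also have "\<dots> = (\<Sum>m\<in>{0..<n}. if m = k then A $$ (k, k) * B $$ (k, k) else 0)"
  proof (rule sum.cong[OF refl])
    fix m assume m: "m \<in> {0..<n}"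
    show "A $$ (k, m) * B $$ (m, k) = (if m = k then A $$ (k, k) * B $$ (k, k) else 0)"
      using upper_triangularD[OF c(2), of m k] upper_triangularD[OF c(4), of k m] c k m
      by (cases m k rule: linorder_cases) auto
  qed
  finally show ?thesis using k by simp
qed

lemma borel_mult_closed:
  assumes A: "A \<in> borel_alg n" and B: "B \<in> borel_alg n"
  shows "A * B \<in> borel_alg n"
proof -
  note c = borel_algD[OF A] borel_algD[OF B]
  have "A $$ (i, m) * B $$ (m, j) = 0" if "i < n" "j < i" "m < n" for i j m
    using upper_triangularD[OF c(2), of m i] upper_triangularD[OF c(4), of j m] c that
    by (cases "m < i") auto
  then show ?thesis
    using c by (auto simp: borel_alg_iff scalar_prod_def intro!: sum.neutral)
qed

lemma one_in_borel_alg: "1\<^sub>m n \<in> borel_alg n"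
  by (auto simp: borel_alg_def)

lemma borel_grp_in_borel_alg:
  assumes "b \<in> borel_grp n"
  shows "b \<in> borel_alg n"
  using assms minv_props(1) by (auto simp: borel_grp_def borel_alg_def)

lemma spectrum_borel:
  assumes "r \<in> borel_alg n"
  shows "spectrum r = (\<lambda>k. r $$ (k, k)) ` {..<n}"
proof -
  note r = borel_algD[OF assms]
  have "eigenvalue r a \<longleftrightarrow> a \<in> (\<lambda>k. r $$ (k, k)) ` {..<n}" for a
    using eigenvalue_root_char_poly[OF r(1), of a] char_poly_upper_triangular[OF r] r(1)
    by (auto simp: diag_mat_def poly_prod_list o_def image_iff)
  then show ?thesis unfolding spectrum_def by blast
qed

text \<open>
  The spectrum is the image of the \<open>n\<close> indices under the diagonal, and an image of a finite set has
  full size only under an injective map.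
\<close>

lemma card_spectrum_borel_iff:
  assumes "r \<in> borel_alg n"
  shows "card (spectrum r) = n \<longleftrightarrow> inj_on (\<lambda>k. r $$ (k, k)) {..<n}"
  using eq_card_imp_inj_on[of "{..<n}" "\<lambda>k. r $$ (k, k)"]
    card_image[of "\<lambda>k. r $$ (k, k)" "{..<n}"]
  unfolding spectrum_borel[OF assms] by auto

section \<open>The trace formula\<close>

lemma l_mat_borel:
  assumes "r \<in> borel_alg n"
  shows "l_mat n m r \<in> borel_alg n"
    and "k < n \<Longrightarrow> l_mat n m r $$ (k, k) = r $$ (k, k) - r $$ (m, m)"
  using assms by (auto simp: l_mat_def borel_alg_iff)

lemma l_prod_borel:
  assumes r: "r \<in> borel_alg n"
  shows "l_prod n \<iota> r \<in> borel_alg n"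
    and "k < n \<Longrightarrow> l_prod n \<iota> r $$ (k, k) = (\<Prod>m\<in>{..<n} - {\<iota>}. r $$ (k, k) - r $$ (m, m))"
proof -
  define P where "P ms = foldr (\<lambda>k M. l_mat n k r * M) ms (1\<^sub>m n)" for ms
  have closed: "P ms \<in> borel_alg n" for ms
    by (induction ms) (auto simp: P_def one_in_borel_alg borel_mult_closed l_mat_borel(1)[OF r])
  show "l_prod n \<iota> r \<in> borel_alg n"
    using closed by (simp add: l_prod_def P_def)
  assume k: "k < n"
  have P_Cons: "P (m # ms) = l_mat n m r * P ms" for m ms
    by (simp add: P_def)
  have "P ms $$ (k, k) = (\<Prod>m\<leftarrow>ms. r $$ (k, k) - r $$ (m, m))" for ms
  proof (induction ms)
    case Nil
    show ?case using k by (simp add: P_def)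
  next
    case (Cons m ms)
    then show ?case
      using borel_mult_diag[OF l_mat_borel(1)[OF r] closed k] l_mat_borel(2)[OF r k]
      by (simp add: P_Cons)
  qed
  then have "l_prod n \<iota> r $$ (k, k)
      = (\<Prod>m\<leftarrow>filter (\<lambda>k. k \<noteq> \<iota>) [0..<n]. r $$ (k, k) - r $$ (m, m))"
    by (simp add: l_prod_def P_def)
  also have "\<dots> = (\<Prod>m\<in>set (filter (\<lambda>k. k \<noteq> \<iota>) [0..<n]). r $$ (k, k) - r $$ (m, m))"
    by (rule prod.distinct_set_conv_list[symmetric]) simp
  also have "set (filter (\<lambda>k. k \<noteq> \<iota>) [0..<n]) = {..<n} - {\<iota>}"
    by auto
  finally show "l_prod n \<iota> r $$ (k, k) = (\<Prod>m\<in>{..<n} - {\<iota>}. r $$ (k, k) - r $$ (m, m))" .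
qed

text \<open>
  The case \<open>A = 1\<close> gives the trace of the product itself, the case \<open>A = r\<close> the trace in the
  numerator of the formula for \<open>H_\<iota>\<close>.
\<close>

lemma trace_l_prod_mult:
  assumes r: "r \<in> borel_alg n" and A: "A \<in> borel_alg n" and \<iota>: "\<iota> < n"
  shows "mat_trace (l_prod n \<iota> r * A)
    = (\<Prod>m\<in>{..<n} - {\<iota>}. r $$ (\<iota>, \<iota>) - r $$ (m, m)) * A $$ (\<iota>, \<iota>)"
proof -
  note L = l_prod_borel[OF r, where \<iota> = \<iota>]
  have "mat_trace (l_prod n \<iota> r * A) = (\<Sum>k<n. l_prod n \<iota> r $$ (k, k) * A $$ (k, k))"
    using borel_algD(1)[OF L(1)] borel_mult_diag[OF L(1) A] by (simp add: mat_trace_def)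
  also have "\<dots> = (\<Sum>k<n. if k = \<iota> then l_prod n \<iota> r $$ (\<iota>, \<iota>) * A $$ (\<iota>, \<iota>) else 0)"
  proof (rule sum.cong[OF refl])
    fix k assume k: "k \<in> {..<n}"
    (* For k different from \<iota>, the factor with index m = k vanishes. *)
    have "l_prod n \<iota> r $$ (k, k) = 0" if "k \<noteq> \<iota>"
      using that k L(2) by (auto intro!: prod_zero bexI[of _ k])
    then show "l_prod n \<iota> r $$ (k, k) * A $$ (k, k)
        = (if k = \<iota> then l_prod n \<iota> r $$ (\<iota>, \<iota>) * A $$ (\<iota>, \<iota>) else 0)"
      by auto
  qed
  finally show ?thesis using \<iota> L(2) by simp
qed

section \<open>Stability and invariance under the Borel group\<close>

text \<open>
  Comparing the diagonals in \<open>b b\<inverse> = 1\<close> gives \<open>b_kk (b\<inverse>)_kk = 1\<close>, and these two scalars are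
  the factors that conjugation puts on \<open>r_kk\<close>.
\<close>

lemma conj_borel:
  assumes b: "b \<in> borel_grp n" and r: "r \<in> borel_alg n"
  shows "b * r * minv n b \<in> borel_alg n"
    and "k < n \<Longrightarrow> (b * r * minv n b) $$ (k, k) = r $$ (k, k)"
proof -
  note B = borel_grp_in_borel_alg[OF b] and C = minv_upper[OF b]
  note br = borel_mult_closed[OF B r]
  show "b * r * minv n b \<in> borel_alg n"
    by (rule borel_mult_closed[OF br C])
  assume k: "k < n"
  have "b $$ (k, k) * minv n b $$ (k, k) = 1"
    using borel_mult_diag[OF B C k] minv_props(3)[of b n] b k by (simp add: borel_grp_def)
  then show "(b * r * minv n b) $$ (k, k) = r $$ (k, k)"
    by (simp add: borel_mult_diag[OF br C k] borel_mult_diag[OF B r k] algebra_simps)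
qed

lemma cls_eq_zero_iff:
  assumes v: "v \<in> carrier_mat n n"
  shows "cls n v = cls n (0\<^sub>m n n) \<longleftrightarrow> v \<in> nil_alg n"
proof
  assume "cls n v = cls n (0\<^sub>m n n)"
  then obtain u where "u \<in> nil_alg n" "v = u + 0\<^sub>m n n"
    using cls_self[OF v] by (auto simp: cls_iff)
  then show "v \<in> nil_alg n" by (auto simp: nil_alg_def)
next
  assume "v \<in> nil_alg n"
  then show "cls n v = cls n (0\<^sub>m n n)"
    using cls_shift[of v n "0\<^sub>m n n"] v by simp
qed

lemma conj_mult:
  assumes b: "b \<in> Units (gl n)" and A: "A \<in> carrier_mat n n" and D: "D \<in> carrier_mat n n"
  shows "(b * A * minv n b) * (b * D * minv n b) = b * (A * D) * minv n b"
proof -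
  define c where "c = minv n b"
  note P = minv_props[OF b, folded c_def]
  have "(b * A * c) * (b * D * c) = b * A * ((c * b) * (D * c))"
    using P(1,2) A D by (simp add: assoc_mult_mat[of _ n n _ n _ n])
  also have "\<dots> = b * (A * D) * c"
    unfolding P(4) using P(1,2) A D by (simp add: assoc_mult_mat[of _ n n _ n _ n])
  finally show ?thesis unfolding c_def .
qed

text \<open>
  In \<open>r v\<close> and \<open>v r\<close> the inner factors \<open>b\<inverse> b\<close> cancel, and \<open>(b i)(j b\<inverse>)\<close> is already the
  conjugate of \<open>i j\<close>, so each of the three terms is conjugated by \<open>b\<close>. This is an identity of matrices; the passage to classes modulo \<open>\<uu>\<close> happens only
  in \<open>act_moment_zero_rss\<close>.
\<close>

lemma moment_map_equivariant:
  assumes b: "b \<in> Units (gl n)"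
    and r: "r \<in> carrier_mat n n" and v: "v \<in> carrier_mat n n"
    and i: "i \<in> carrier_mat n 1" and j: "j \<in> carrier_mat 1 n"
  shows "((b * r * minv n b) * (b * v * minv n b) - (b * v * minv n b) * (b * r * minv n b))
      + (b * i) * (j * minv n b)
    = b * ((r * v - v * r) + i * j) * minv n b"
proof -
  define c where "c = minv n b"
  note P = minv_props[OF b, folded c_def]
  have ij: "(b * i) * (j * c) = b * (i * j) * c"
    using P(1,2) i j
    by (simp add: assoc_mult_mat[of _ n n _ 1 _ n] assoc_mult_mat[of _ n 1 _ n _ n]
        assoc_mult_mat[of _ n n _ n _ n])
  have "b * ((r * v - v * r) + i * j) * c
      = b * (r * v - v * r) * c + b * (i * j) * c"
  proof -
    have carrier: "r * v - v * r \<in> carrier_mat n n" "i * j \<in> carrier_mat n n"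
      using r v i j by auto
    show ?thesis
      using P(1,2) carrier mult_add_distrib_mat[OF P(1) carrier]
        add_mult_distrib_mat[of "b * (r * v - v * r)" n n "b * (i * j)" c n] by auto
  qed
  also have "b * (r * v - v * r) * c = b * (r * v) * c - b * (v * r) * c"
    using P(1,2) r v
    by (simp add: mult_minus_distrib_mat[of _ n n _ n] minus_mult_distrib_mat[of _ n n _ _ n])
  finally show ?thesis
    unfolding ij[unfolded c_def] c_def conj_mult[OF b r v] conj_mult[OF b v r] by simp
qed

text \<open>
  Choosing a representative \<open>v\<close> of the class in \<open>\<gg>/\<uu>\<close> turns the moment map equation into the
  membership \<open>[r, v] + i j \<in> \<uu>\<close>, and the condition on the spectrum into distinctness of the
  diagonal entries.
\<close>

lemma moment_zero_rssE:
  assumes "x \<in> moment_zero_rss n"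
  obtains r v i j where "x = (r, cls n v, i, j)" "r \<in> borel_alg n" "v \<in> carrier_mat n n"
    "i \<in> carrier_mat n 1" "j \<in> carrier_mat 1 n" "(r * v - v * r) + i * j \<in> nil_alg n"
    "inj_on (\<lambda>k. r $$ (k, k)) {..<n}"
proof -
  obtain r s i j where x: "x = (r, s, i, j)" by (cases x)
  have mem: "r \<in> borel_alg n" "s \<in> borel_dual n" "i \<in> carrier_mat n 1" "j \<in> carrier_mat 1 n"
    and mu: "moment n (r, s, i, j) = cls n (0\<^sub>m n n)" and sp: "card (spectrum r) = n"
    using assms unfolding x moment_zero_rss_def moment_zero_def cotangent_def by auto
  obtain v where v: "s = cls n v" "v \<in> carrier_mat n n"
    using mem(2) by (auto simp: borel_dual_eq)
  have "(r * v - v * r) + i * j \<in> carrier_mat n n"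
    using borel_algD(1)[OF mem(1)] v(2) mem(3,4) by auto
  then have "(r * v - v * r) + i * j \<in> nil_alg n"
    using mu cls_eq_zero_iff unfolding v(1) moment_cls[OF mem(1) v(2) mem(3,4)] by blast
  then show thesis
    using that x v mem sp card_spectrum_borel_iff by blast
qed

text \<open>
  By equivariance the new value of \<open>[r, v] + i j\<close> is the conjugate of the old one, which stays in
  \<open>\<uu>\<close> because the product of a strictly upper triangular matrix with upper triangular ones is
  strictly upper triangular. The diagonal of \<open>r\<close>, hence its regularity, does not change.
\<close>

lemma act_moment_zero_rss:
  assumes b: "b \<in> borel_grp n" and x: "x \<in> moment_zero_rss n"
  shows "act n b x \<in> moment_zero_rss n"
proof -
  obtain r v i j where xe: "x = (r, cls n v, i, j)"
    and r: "r \<in> borel_alg n" and v: "v \<in> carrier_mat n n"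
    and i: "i \<in> carrier_mat n 1" and j: "j \<in> carrier_mat 1 n"
    and mu: "(r * v - v * r) + i * j \<in> nil_alg n" and rss: "inj_on (\<lambda>k. r $$ (k, k)) {..<n}"
    using x by (rule moment_zero_rssE)
  have bU: "b \<in> Units (gl n)" using b by (simp add: borel_grp_def)
  define c where "c = minv n b"
  note P = minv_props(1,2)[OF bU, folded c_def]
  note conj = conj_borel[OF b r, folded c_def]
  have mem: "b * v * c \<in> carrier_mat n n" "b * i \<in> carrier_mat n 1" "j * c \<in> carrier_mat 1 n"
    using P v i j by auto
  have "b * ((r * v - v * r) + i * j) * c \<in> nil_alg n"
    using nil_alg_mult(1)[OF nil_alg_mult(2)[OF mu borel_grp_in_borel_alg[OF b]] minv_upper[OF b]]
    by (simp add: c_def)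
  then have "cls n (((b * r * c) * (b * v * c) - (b * v * c) * (b * r * c)) + (b * i) * (j * c))
      = cls n (0\<^sub>m n n)"
    using moment_map_equivariant[OF bU borel_algD(1)[OF r] v i j] cls_eq_zero_iff
    by (auto simp: c_def nil_alg_def)
  then have "moment n (b * r * c, cls n (b * v * c), b * i, j * c) = cls n (0\<^sub>m n n)"
    using moment_cls[OF conj(1) mem] by simp
  moreover have "card (spectrum (b * r * c)) = n"
  proof -
    have "inj_on (\<lambda>k. (b * r * c) $$ (k, k)) {..<n}"
      using rss conj(2) by (simp add: inj_on_def)
    then show ?thesis using card_spectrum_borel_iff[OF conj(1)] by blast
  qed
  ultimately show ?thesis
    unfolding xe act_cls[OF b v] c_def[symmetric]
    using conj(1) mem
    by (auto simp: moment_zero_rss_def moment_zero_def cotangent_def borel_dual_eq)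
qed

lemma H_fun_invariant:
  assumes \<iota>: "\<iota> < n"
  shows "B_invariant_on n (moment_zero_rss n) (H_fun \<iota>)"
  unfolding B_invariant_on_def
proof (intro ballI conjI)
  fix b x assume b: "b \<in> borel_grp n" and x: "x \<in> moment_zero_rss n"
  then show "act n b x \<in> moment_zero_rss n" by (rule act_moment_zero_rss)
  show "H_fun \<iota> (act n b x) = H_fun \<iota> x"
    using x by (rule moment_zero_rssE) (simp add: act_def H_fun_def conj_borel(2)[OF b _ \<iota>])
qed

theorem proposition6p10:
  fixes n \<iota> :: nat
  assumes "n \<ge> 1" and "\<iota> < n"
  shows "(\<forall>(r, s, i, j) \<in> moment_zero_rss n.
            mat_trace (l_prod n \<iota> r) \<noteq> 0 \<and>
            H_fun \<iota> (r, s, i, j)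
              = inverse (mat_trace (l_prod n \<iota> r)) * mat_trace (l_prod n \<iota> r * r))
         \<and> B_invariant_on n (moment_zero_rss n) (H_fun \<iota>)"
proof -
  have "mat_trace (l_prod n \<iota> r) \<noteq> 0 \<and>
      H_fun \<iota> (r, s, i, j)
        = inverse (mat_trace (l_prod n \<iota> r)) * mat_trace (l_prod n \<iota> r * r)"
    if x: "(r, s, i, j) \<in> moment_zero_rss n" for r s i j
  proof -
    have r: "r \<in> borel_alg n" and inj: "inj_on (\<lambda>k. r $$ (k, k)) {..<n}"
      using moment_zero_rssE[OF x] by auto
    (* This product is the trace in the denominator. *)
    have "(\<Prod>m\<in>{..<n} - {\<iota>}. r $$ (\<iota>, \<iota>) - r $$ (m, m)) \<noteq> 0"
      using inj assms(2) by (auto simp: inj_on_def)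
    moreover have "l_prod n \<iota> r * 1\<^sub>m n = l_prod n \<iota> r"
      using borel_algD(1)[OF l_prod_borel(1)[OF r, where \<iota> = \<iota>]] by simp
    ultimately show ?thesis
      using trace_l_prod_mult[OF r r assms(2)] trace_l_prod_mult[OF r one_in_borel_alg assms(2)]
        assms(2)
      by (simp add: H_fun_def)
  qed
  then show ?thesis
    using H_fun_invariant[OF assms(2)] by auto
qed

end
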